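(* Let $\mathcal{A}\subset\mathbb{R}^2$ be a finitely generated additive subgroup of rank $\le 3$. Then $\mathcal{A}$ has only finitely many elements on the unit circle $S^1$, i.e. the set $\mathcal{A}\cap S^1$ is finite.
   Context: $S^1=\{v\in\mathbb{R}^2 : \|v\|=1\}$ is the unit circle for the Euclidean norm, centred at the origin. A finitely generated additive subgroup of $\mathbb{R}^2$ is a free abelian group of finite rank; its rank is the cardinality of a $\mathbb{Z}$-basis (no discreteness is assumed). *)

theory Defs
  imports "HOL-Analysis.Analysis"
begin

abbreviation zscale :: "int \<Rightarrow> 'a::real_vector \<Rightarrow> 'a" where
  "zscale n x \<equiv> real_of_int n *\<^sub>R x"

global_interpretation zmod: module "zscale :: int \<Rightarrow> 'a::real_vector \<Rightarrow> 'a"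
  by unfold_locales (simp_all add: algebra_simps)

definition additive_subgroup :: "'a::ab_group_add set \<Rightarrow> bool" where
  "additive_subgroup A \<longleftrightarrow>
     0 \<in> A \<and> (\<forall>x\<in>A. \<forall>y\<in>A. x + y \<in> A) \<and> (\<forall>x\<in>A. - x \<in> A)"

definition fin_gen :: "'a::real_vector set \<Rightarrow> bool" where
  "fin_gen A \<longleftrightarrow> (\<exists>G. finite G \<and> zmod.span G = A)"

definition z_basis :: "'a::real_vector set \<Rightarrow> 'a set \<Rightarrow> bool" where
  "z_basis B A \<longleftrightarrow> \<not> zmod.dependent B \<and> zmod.span B = A"

(* Meaningful for finitely generated A: being torsion-free, such an A has a Z-basis, every
   Z-basis of A is finite, and any two have the same cardinality, so the choice is immaterial. *)
definition z_rank :: "'a::real_vector set \<Rightarrow> nat" where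
  "z_rank A = card (SOME B. z_basis B A)"

end

theory Submission
  imports Defs
begin

text \<open>
  Suppose that there are infinitely many unit vectors in \<open>A\<close>. Elements of \<open>A\<close> with coordinates in a
  proper rational subspace lie in a group of rank two, which meets the circle in a finite set, so
  some three unit vectors \<open>e\<close>, \<open>u\<close>, \<open>v\<close> of \<open>A\<close> generate a subgroup of finite index and are independent
  over the integers. With \<open>a = e \<bullet> u\<close>, \<open>b = e \<bullet> v\<close>, \<open>c = u \<bullet> v\<close>, the unit vectors give integer
  solutions of \<open>X\<^sup>2 + Y\<^sup>2 + Z\<^sup>2 + 2 (a X Y + b X Z + c Y Z) = K\<^sup>2\<close>. If the vectors
  \<open>(X Y, X Z, Y Z)\<close> span a space of dimension three, then \<open>a\<close>, \<open>b\<close>, \<open>c\<close> are rational, and so is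
  the kernel of the Gram matrix, a contradiction. Otherwise all of them are orthogonal to one integer
  vector \<open>(r, s, t)\<close>, all of whose entries are nonzero, and \<open>(a, b, c) = \<mu> (r, s, t) + (0, \<beta>, \<gamma>)\<close>
  with \<open>\<beta>\<close>, \<open>\<gamma>\<close> rational. The determinant of the Gram matrix is a rational cubic in \<open>\<mu>\<close> that
  vanishes; its derivative is a multiple of \<open>r w1 w2 + s w1 w3 + t w2 w3\<close>, where \<open>w\<close> spans the
  kernel. As the solutions go to infinity in the direction \<open>w\<close>, that vanishes too. A double root of a
  rational cubic is rational, so \<open>a\<close>, \<open>b\<close>, \<open>c\<close> are rational after all.
\<close>

section \<open>Integer bases of finitely generated groups\<close>

lemma zspan_reduce_of_relation:
  fixes G :: "'a::real_vector set"
  assumes "finite G" "(\<Sum>g\<in>G. zscale (u g) g) = 0" "\<exists>g\<in>G. u g \<noteq> 0"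
  shows "\<exists>G'. finite G' \<and> card G' < card G \<and> zmod.span G' = zmod.span G"
  using assms
proof (induction "\<Sum>g\<in>G. nat \<bar>u g\<bar>" arbitrary: G u rule: less_induct)
  case less
  obtain g where g: "g \<in> G" "u g \<noteq> 0" using less.prems by blast
  show ?case
  proof (cases "\<exists>h\<in>G. h \<noteq> g \<and> u h \<noteq> 0")
    case False
    have "(\<Sum>h\<in>G. zscale (u h) h) = zscale (u g) g"
      using False g less.prems(1) by (subst sum.remove[of _ g]) (auto intro!: sum.neutral)
    then have "g = 0" using less.prems(2) g by simp
    then have "G \<subseteq> zmod.span (G - {g})" "G - {g} \<subseteq> zmod.span G"
      using zmod.span_zero by (auto intro: zmod.span_base)
    then have "zmod.span (G - {g}) = zmod.span G" by (simp add: zmod.span_eq)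
    moreover have "card (G - {g}) < card G"
      using g(1) less.prems(1) by (intro card_Diff1_less)
    ultimately show ?thesis using less.prems(1) by (metis finite_Diff)
  next
    case True
    then obtain h where h: "h \<in> G" "h \<noteq> g" "u h \<noteq> 0" by blast
    obtain i j where ij: "i \<in> G" "j \<in> G" "i \<noteq> j" "u i \<noteq> 0" "u j \<noteq> 0" "\<bar>u j\<bar> \<le> \<bar>u i\<bar>"
      by (metis g h linorder_le_cases)
    \<comment> \<open>The sign makes the moduli subtract: \<open>u i - \<epsilon> * u j\<close> has
      modulus \<open>\<bar>u i\<bar> - \<bar>u j\<bar>\<close>.\<close>
    define \<epsilon> where "\<epsilon> = sgn (u i) * sgn (u j)"
    have eps: "\<epsilon> = 1 \<or> \<epsilon> = -1" using ij by (auto simp: \<epsilon>_def sgn_if)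
    \<comment> \<open>A Euclidean step: trading \<open>j\<close> for \<open>j + \<epsilon> i\<close> changes the coefficient of \<open>i\<close> to \<open>u i - \<epsilon> u j\<close>.\<close>
    define k where "k = j + zscale \<epsilon> i"
    define H where "H = G - {j}"
    have H: "i \<in> H" "j \<notin> H" "finite H" "G = insert j H" using ij less.prems by (auto simp: H_def)
    have spk: "zmod.span (insert k H) = zmod.span G"
    proof (rule zmod.span_eq[THEN iffD2], intro conjI)
      have "k \<in> zmod.span G"
        unfolding k_def by (intro zmod.span_add zmod.span_scale zmod.span_base ij)
      then show "insert k H \<subseteq> zmod.span G"
        using H by (auto intro: zmod.span_base)
      have "j = k - zscale \<epsilon> i" by (simp add: k_def)
      moreover have "k - zscale \<epsilon> i \<in> zmod.span (insert k H)"
        by (intro zmod.span_diff zmod.span_scale zmod.span_base) (use H in auto)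
      ultimately show "G \<subseteq> zmod.span (insert k H)"
        using H by (auto intro: zmod.span_base)
    qed
    have cG: "card G = Suc (card H)" using H by simp
    \<comment> \<open>If \<open>k\<close> is already among the other generators, the exchange itself
      loses one.\<close>
    show ?thesis
    proof (cases "k \<in> H")
      case True
      then have "zmod.span H = zmod.span G" using spk by (simp add: insert_absorb)
      then show ?thesis using H cG by auto
    next
      case False
      define u' where "u' = u(i := u i - \<epsilon> * u j, k := u j)"
      have ik: "i \<noteq> k" using False H by auto
      have ji: "j \<noteq> i" using ij by auto
      define R where "R = H - {i}"
      have R: "H = insert i R" "i \<notin> R" "finite R" "k \<notin> R" "j \<notin> R"
        using H False by (auto simp: R_def)
      have u'R: "u' g = u g" if "g \<in> R" for g using that R by (auto simp: u'_def)
      have s1: "(\<Sum>g\<in>G. zscale (u g) g) = zscale (u j) j + (zscale (u i) i + (\<Sum>g\<in>R. zscale (u g) g))"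
        using R H ji by simp
      have s2: "(\<Sum>g\<in>insert k H. zscale (u' g) g)
          = zscale (u j) k + (zscale (u i - \<epsilon> * u j) i + (\<Sum>g\<in>R. zscale (u g) g))"
        using R H ik u'R by (simp add: u'_def)
      have "(\<Sum>g\<in>insert k H. zscale (u' g) g) = 0"
        using less.prems(2) unfolding s1 s2 by (simp add: k_def algebra_simps)
      moreover have "\<exists>g\<in>insert k H. u' g \<noteq> 0" using ij by (auto simp: u'_def)
      moreover have "(\<Sum>g\<in>insert k H. nat \<bar>u' g\<bar>) < (\<Sum>g\<in>G. nat \<bar>u g\<bar>)"
      proof -
        have n1: "(\<Sum>g\<in>G. nat \<bar>u g\<bar>) = nat \<bar>u j\<bar> + (nat \<bar>u i\<bar> + (\<Sum>g\<in>R. nat \<bar>u g\<bar>))"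
          using R H ji by simp
        have n2: "(\<Sum>g\<in>insert k H. nat \<bar>u' g\<bar>) = nat \<bar>u j\<bar> + (nat \<bar>u i - \<epsilon> * u j\<bar> + (\<Sum>g\<in>R. nat \<bar>u g\<bar>))"
          using R H ik u'R by (simp add: u'_def)
        have "\<bar>u i - \<epsilon> * u j\<bar> < \<bar>u i\<bar>"
          using ij by (auto simp: \<epsilon>_def sgn_if)
        then show ?thesis unfolding n1 n2 by linarith
      qed
      ultimately have "\<exists>G'. finite G' \<and> card G' < card (insert k H) \<and> zmod.span G' = zmod.span (insert k H)"
        using less.hyps[of u' "insert k H"] H by blast
      then show ?thesis using spk cG H False by auto
    qed
  qed
qed

lemma z_basis_exists:
  fixes G :: "'a::real_vector set"
  assumes "finite G"
  shows "\<exists>B. z_basis B (zmod.span G)"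
  using assms
proof (induction "card G" arbitrary: G rule: less_induct)
  case less
  show ?case
  proof (cases "zmod.dependent G")
    case True
    then obtain G' where "finite G'" "card G' < card G" "zmod.span G' = zmod.span G"
      using zspan_reduce_of_relation[OF less.prems] less.prems
      by (auto simp: zmod.dependent_finite)
    then show ?thesis using less.hyps by metis
  qed (auto simp: z_basis_def)
qed

text \<open>The finitely many generators involve only a finite part of \<open>B\<close>; any further
  element of \<open>B\<close> would be an integer combination of that part, against
  independence.\<close>

lemma z_basis_finite:
  fixes B :: "'a::real_vector set"
  assumes "z_basis B A" "fin_gen A"
  shows "finite B"
proof -
  obtain G where G: "finite G" "zmod.span G = A" using assms by (auto simp: fin_gen_def)
  have "\<exists>S. finite S \<and> S \<subseteq> B \<and> g \<in> zmod.span S" if "g \<in> G" for g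
  proof -
    have "g \<in> zmod.span B" using that G assms(1) zmod.span_base[of g G] by (auto simp: z_basis_def)
    then obtain t r where "finite t" "t \<subseteq> B" "g = (\<Sum>a\<in>t. zscale (r a) a)"
      unfolding zmod.span_explicit by blast
    moreover from this have "g \<in> zmod.span t"
      by (auto intro: zmod.span_sum zmod.span_scale zmod.span_base)
    ultimately show ?thesis by blast
  qed
  then obtain S where S: "\<And>g. g \<in> G \<Longrightarrow> finite (S g) \<and> S g \<subseteq> B \<and> g \<in> zmod.span (S g)" by metis
  define B' where "B' = (\<Union>g\<in>G. S g)"
  have B': "finite B'" "B' \<subseteq> B" using S G by (auto simp: B'_def)
  have "G \<subseteq> zmod.span B'"
  proof
    fix g assume "g \<in> G"
    then have "g \<in> zmod.span (S g)" "S g \<subseteq> B'" using S by (auto simp: B'_def)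
    then show "g \<in> zmod.span B'" using zmod.span_mono by blast
  qed
  then have "A \<subseteq> zmod.span B'"
    using G(2) zmod.span_minimal[OF _ zmod.subspace_span] by blast
  have "B \<subseteq> B'"
  proof
    fix x assume x: "x \<in> B"
    show "x \<in> B'"
    proof (rule ccontr)
      assume "x \<notin> B'"
      then have "B' \<subseteq> B - {x}" using B' by auto
      moreover have "x \<in> zmod.span B'"
        using \<open>A \<subseteq> _\<close> x assms(1) zmod.span_base[of x B] by (auto simp: z_basis_def)
      ultimately have "x \<in> zmod.span (B - {x})" using zmod.span_mono by blast
      then obtain t u where tu: "finite t" "t \<subseteq> B - {x}" "x = (\<Sum>a\<in>t. zscale (u a) a)"
        unfolding zmod.span_explicit by blast
      have "(\<Sum>a\<in>t. zscale ((u(x := -1)) a) a) = (\<Sum>a\<in>t. zscale (u a) a)"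
        using tu(2) by (intro sum.cong) auto
      then have "(\<Sum>a\<in>insert x t. zscale ((u(x := -1)) a) a) = 0"
        using tu by (subst sum.insert) auto
      then have "(u(x := -1)) x = 0"
        using assms(1) tu x unfolding z_basis_def
        by (intro zmod.independentD[of B "insert x t" "u(x := -1)"]) auto
      then show False by simp
    qed
  qed
  then show ?thesis using B' finite_subset by blast
qed

text \<open>Turns the rank bound into integer coordinates. These need not be unique:
  \<open>p\<close>, \<open>q\<close>, \<open>r\<close> may coincide or vanish.\<close>

lemma three_generators:
  fixes A :: "'a::real_vector set"
  assumes "fin_gen A" "z_rank A \<le> 3"
  obtains p q r where "\<And>x. x \<in> A \<Longrightarrow> \<exists>X Y Z. x = zscale X p + zscale Y q + zscale Z r"
proof -
  obtain G where "finite G" "zmod.span G = A" using assms by (auto simp: fin_gen_def)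
  then have "\<exists>B. z_basis B A" using z_basis_exists by blast
  then have B: "z_basis (SOME B. z_basis B A) A" by (rule someI_ex)
  define B where "B = (SOME B. z_basis B A)"
  have B: "z_basis B A" "card B \<le> 3" using B assms(2) by (auto simp: B_def z_rank_def)
  have "finite B" using B assms z_basis_finite by blast
  then obtain xs where xs: "set xs = B" "length xs = card B"
    using finite_distinct_list distinct_card by metis
  \<comment> \<open>Padding by zeros yields three vectors even from a smaller basis.\<close>
  define ys where "ys = xs @ [0, 0, 0]"
  have "B \<subseteq> {ys ! 0, ys ! 1, ys ! 2}"
  proof
    fix x assume "x \<in> B"
    then obtain i where "i < length xs" "xs ! i = x" using xs by (auto simp: in_set_conv_nth)
    moreover from this have "i = 0 \<or> i = 1 \<or> i = 2" using xs B by linarith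
    ultimately show "x \<in> {ys ! 0, ys ! 1, ys ! 2}" by (auto simp: ys_def nth_append)
  qed
  then have A: "A \<subseteq> zmod.span {ys ! 0, ys ! 1, ys ! 2}"
    using B(1) zmod.span_mono unfolding z_basis_def by blast
  show thesis
  proof
    fix x assume "x \<in> A"
    then have "x \<in> zmod.span {ys ! 0, ys ! 1, ys ! 2}" using A by auto
    then obtain X Y Z where "x - zscale X (ys ! 0) - zscale Y (ys ! 1) - zscale Z (ys ! 2) = 0"
      unfolding zmod.span_breakdown_eq zmod.span_empty by auto
    then have "x = zscale X (ys ! 0) + zscale Y (ys ! 1) + zscale Z (ys ! 2)" 
      by (simp add: algebra_simps)
    then show "\<exists>X Y Z. x = zscale X (ys ! 0) + zscale Y (ys ! 1) + zscale Z (ys ! 2)" by blast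
  qed
qed

section \<open>Determinants and inner products in the plane\<close>

definition det2 :: "real ^ 2 \<Rightarrow> real ^ 2 \<Rightarrow> real" where
  "det2 x y = x $ 1 * y $ 2 - x $ 2 * y $ 1"

lemma det2_add_left: "det2 (x + y) z = det2 x z + det2 y z"
  and det2_scale_left: "det2 (k *\<^sub>R x) z = k * det2 x z"
  and det2_self [simp]: "det2 x x = 0"
  and det2_swap: "det2 y x = - det2 x y"
  by (simp_all add: det2_def algebra_simps)

text \<open>The Cauchy-Binet formula. It makes products of determinants polynomials in inner
  products.\<close>

lemma det2_mult: "det2 x y * det2 z w = (x \<bullet> z) * (y \<bullet> w) - (x \<bullet> w) * (y \<bullet> z)"
  by (simp add: det2_def inner_vec_def sum_2 algebra_simps)

text \<open>Cramer's rule; the coefficients form a vector in the kernel of the Gram matrix of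
  \<open>e\<close>, \<open>u\<close>, \<open>v\<close>.\<close>

lemma det2_relation: "det2 u v *\<^sub>R e + det2 v e *\<^sub>R u + det2 e u *\<^sub>R v = 0"
  by (simp add: det2_def vec_eq_iff forall_2 algebra_simps)

lemma abs_det2_le: "\<bar>det2 x y\<bar> \<le> norm x * norm y"
proof -
  have "(norm x * norm y)\<^sup>2 = (det2 x y)\<^sup>2 + (x \<bullet> y)\<^sup>2"
    using det2_mult[of x y x y]
    by (simp add: power_mult_distrib power2_norm_eq_inner inner_commute[of y x])
      (simp add: power2_eq_square)
  then have "\<bar>det2 x y\<bar>\<^sup>2 \<le> (norm x * norm y)\<^sup>2" by simp
  then show ?thesis by (rule power2_le_imp_le) simp
qed

section \<open>Circles and groups of rank at most two\<close>

lemma finite_int_abs_le: "finite {X::int. \<bar>real_of_int X\<bar> \<le> R}"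
proof (rule finite_subset)
  show "{X::int. \<bar>real_of_int X\<bar> \<le> R} \<subseteq> {-\<lfloor>R\<rfloor>..\<lfloor>R\<rfloor>}"
  proof
    fix X :: int
    assume "X \<in> {X::int. \<bar>real_of_int X\<bar> \<le> R}"
    then have "\<bar>X\<bar> \<le> \<lfloor>R\<rfloor>" by (simp add: le_floor_iff)
    then show "X \<in> {-\<lfloor>R\<rfloor>..\<lfloor>R\<rfloor>}" by auto
  qed
qed simp

lemma finite_line_circle:
  assumes "f \<noteq> 0"
  shows "finite {m. det2 m f = 0 \<and> norm m = K}"
proof (rule finite_subset)
  show "{m. det2 m f = 0 \<and> norm m = K} \<subseteq> {(K / norm f) *\<^sub>R f, - (K / norm f) *\<^sub>R f}"
  proof
    fix m assume "m \<in> {m. det2 m f = 0 \<and> norm m = K}"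
    then have m: "det2 m f = 0" "norm m = K" by auto
    \<comment> \<open>Decomposition along \<open>f\<close> and along \<open>f\<close> turned by a
      right angle.\<close>
    have "(f \<bullet> f) *\<^sub>R m = (m \<bullet> f) *\<^sub>R f + det2 m f *\<^sub>R vector [f $ 2, - f $ 1]"
      by (simp add: det2_def inner_vec_def sum_2 vec_eq_iff forall_2 algebra_simps)
    then have l: "(f \<bullet> f) *\<^sub>R m = (m \<bullet> f) *\<^sub>R f" using m by simp
    have ff: "f \<bullet> f = norm f * norm f" by (simp flip: power2_norm_eq_inner power2_eq_square)
    have "(m \<bullet> f)\<^sup>2 = (K * norm f)\<^sup>2"
      using det2_mult[of m f m f] m
      by (simp add: power_mult_distrib power2_norm_eq_inner inner_commute[of f m] flip: m(2))
        (simp add: power2_eq_square)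
    then have "m \<bullet> f = K * norm f \<or> m \<bullet> f = - (K * norm f)"
      by (simp only: power2_eq_iff)
    moreover have "m = ((m \<bullet> f) / (f \<bullet> f)) *\<^sub>R f"
    proof -
      have "((m \<bullet> f) / (f \<bullet> f)) *\<^sub>R f = (1 / (f \<bullet> f)) *\<^sub>R ((m \<bullet> f) *\<^sub>R f)" by simp
      then show ?thesis using assms by (simp flip: l)
    qed
    ultimately show "m \<in> {(K / norm f) *\<^sub>R f, - (K / norm f) *\<^sub>R f}"
      using assms unfolding ff by auto
  qed
qed simp

text \<open>If \<open>f\<close>, \<open>g\<close> are independent, Cramer's rule bounds both integer
  coefficients. Otherwise the points lie on one line, which the circle meets at most twice, even if
  the group is dense in it. The factor \<open>k\<close> leaves room for denominators.\<close>

lemma finite_rank2_circle: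
  fixes f g :: "real ^ 2"
  assumes "k \<noteq> 0"
  shows "finite {m. norm m = K \<and> (\<exists>X Y. k *\<^sub>R m = zscale X f + zscale Y g)}" (is "finite ?S")
proof (cases "det2 f g = 0")
  case False
  define R where "R = max (\<bar>k\<bar> * K * norm g / \<bar>det2 f g\<bar>) (\<bar>k\<bar> * K * norm f / \<bar>det2 f g\<bar>)"
  let ?I = "{X::int. \<bar>real_of_int X\<bar> \<le> R}"
  have "?S \<subseteq> (\<lambda>(X, Y). (1 / k) *\<^sub>R (zscale X f + zscale Y g)) ` (?I \<times> ?I)"
  proof clarify
    fix m X Y assume K: "K = norm m" and m: "k *\<^sub>R m = zscale X f + zscale Y g"
    have "k * det2 m g = X * det2 f g"
      using arg_cong[OF m, of "\<lambda>z. det2 z g"] by (simp add: det2_add_left det2_scale_left)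
    then have "\<bar>real_of_int X\<bar> * \<bar>det2 f g\<bar> = \<bar>k\<bar> * \<bar>det2 m g\<bar>" by (metis abs_mult)
    also have "\<dots> \<le> \<bar>k\<bar> * (norm m * norm g)" by (intro mult_left_mono abs_det2_le) simp
    finally have X: "\<bar>real_of_int X\<bar> \<le> R"
      using False K by (auto simp: R_def field_simps le_max_iff_disj)
    have "k * det2 m f = Y * det2 g f"
      using arg_cong[OF m, of "\<lambda>z. det2 z f"] by (simp add: det2_add_left det2_scale_left)
    then have "\<bar>real_of_int Y\<bar> * \<bar>det2 f g\<bar> = \<bar>k\<bar> * \<bar>det2 m f\<bar>"
      by (metis abs_mult abs_minus_cancel det2_swap)
    also have "\<dots> \<le> \<bar>k\<bar> * (norm m * norm f)" by (intro mult_left_mono abs_det2_le) simp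
    finally have Y: "\<bar>real_of_int Y\<bar> \<le> R"
      using False K by (auto simp: R_def field_simps le_max_iff_disj)
    have "m = (1 / k) *\<^sub>R (zscale X f + zscale Y g)" using assms by (simp flip: m)
    then show "m \<in> (\<lambda>(X, Y). (1 / k) *\<^sub>R (zscale X f + zscale Y g)) ` (?I \<times> ?I)"
      using X Y by (intro image_eqI[of _ _ "(X, Y)"]) auto
  qed
  then show ?thesis by (rule finite_subset) (intro finite_imageI finite_cartesian_product finite_int_abs_le)
next
  case True
  \<comment> \<open>Either of \<open>f\<close>, \<open>g\<close> may be zero, so both determinants
    are kept and the nonzero vector supplies the line.\<close>
  have "det2 m f = 0 \<and> det2 m g = 0" if "k *\<^sub>R m = zscale X f + zscale Y g" for m X Y
    using arg_cong[OF that, of "\<lambda>z. det2 z f"] arg_cong[OF that, of "\<lambda>z. det2 z g"] True assms det2_swap[of g f]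
    by (simp add: det2_add_left det2_scale_left)
  then have sub: "?S \<subseteq> {m. det2 m f = 0 \<and> norm m = K}" "?S \<subseteq> {m. det2 m g = 0 \<and> norm m = K}" by blast+
  show ?thesis
  proof (cases "f = 0 \<and> g = 0")
    case True
    then have "?S \<subseteq> {0}" using assms by auto
    then show ?thesis by (rule finite_subset) simp
  next
    case False
    then show ?thesis
      using finite_subset[OF sub(1) finite_line_circle] finite_subset[OF sub(2) finite_line_circle] by blast
  qed
qed

text \<open>The equation eliminates a coordinate with nonzero coefficient, at the price of
  multiplying the vector by that coefficient; two generators remain.\<close>

lemma finite_plane_circle:
  fixes p q r :: "real ^ 2" and l m n :: int
  assumes "l \<noteq> 0 \<or> m \<noteq> 0 \<or> n \<noteq> 0"
  shows "finite {x. norm x = K \<and> (\<exists>X Y Z. l * X + m * Y + n * Z = 0 \<and>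
           x = zscale X p + zscale Y q + zscale Z r)}" (is "finite ?S")
proof -
  have *: "finite {x. norm x = K \<and> (\<exists>X Y Z. l * X + m * Y + n * Z = 0 \<and>
           x = zscale X p + zscale Y q + zscale Z r)}"
    if "n \<noteq> 0" for l m n :: int and p q r :: "real ^ 2"
  proof (rule finite_subset[OF _ finite_rank2_circle[of "real_of_int n" K "zscale n p - zscale l r" "zscale n q - zscale m r"]])
    have "zscale n (zscale X p + zscale Y q + zscale Z r) =
      zscale X (zscale n p - zscale l r) + zscale Y (zscale n q - zscale m r)"
      if "l * X + m * Y + n * Z = 0" for X Y Z
    proof -
      have "zscale n (zscale X p + zscale Y q + zscale Z r) -
        (zscale X (zscale n p - zscale l r) + zscale Y (zscale n q - zscale m r)) =
          zscale (l * X + m * Y + n * Z) r" by (simp add: algebra_simps)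
      then show ?thesis using that by simp
    qed
    then show "{x. norm x = K \<and> (\<exists>X Y Z. l * X + m * Y + n * Z = 0 \<and>
           x = zscale X p + zscale Y q + zscale Z r)} \<subseteq> {x. norm x = K \<and> (\<exists>X Y. zscale n x =
            zscale X (zscale n p - zscale l r) + zscale Y (zscale n q - zscale m r))}"
      by blast
  qed (use that in auto)
  consider "n \<noteq> 0" | "m \<noteq> 0" | "l \<noteq> 0" using assms by auto
  then show ?thesis
  proof cases
    case 1 then show ?thesis by (rule *)
  next
    case 2
    show ?thesis
    proof (rule finite_subset[OF _ *[OF 2, of l n p r q]], rule subsetI)
      fix x assume "x \<in> ?S"
      then obtain X Y Z where "norm x = K" "l * X + m * Y + n * Z = 0"
        "x = zscale X p + zscale Y q + zscale Z r" by blast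
      then have "norm x = K \<and> l * X + n * Z + m * Y = 0 \<and> x = zscale X p + zscale Z r + zscale Y q"
        by (simp add: add_ac)
      then show "x \<in> {x. norm x = K \<and> (\<exists>X Y Z. l * X + n * Y + m * Z = 0 \<and>
           x = zscale X p + zscale Y r + zscale Z q)}" by blast
    qed
  next
    case 3
    show ?thesis
    proof (rule finite_subset[OF _ *[OF 3, of m n q r p]], rule subsetI)
      fix x assume "x \<in> ?S"
      then obtain X Y Z where "norm x = K" "l * X + m * Y + n * Z = 0"
        "x = zscale X p + zscale Y q + zscale Z r" by blast
      then have "norm x = K \<and> m * Y + n * Z + l * X = 0 \<and> x = zscale Y q + zscale Z r + zscale X p"
        by (simp add: add_ac)
      then show "x \<in> {x. norm x = K \<and> (\<exists>X Y Z. m * X + n * Y + l * Z = 0 \<and>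
           x = zscale X q + zscale Y r + zscale Z p)}" by blast
    qed
  qed
qed

section \<open>Rationality and integer relations\<close>

text \<open>Dividing \<open>9 * A\<close> times the cubic by its derivative leaves a linear
  remainder that vanishes at \<open>x\<close>. If its leading coefficient is zero, the derivative is
  a square up to a constant and \<open>x\<close> is its only root.\<close>

lemma double_root_rational:
  fixes x :: real
  assumes "A \<in> \<rat>" "B \<in> \<rat>" "C \<in> \<rat>" "D \<in> \<rat>" "A \<noteq> 0"
    and "A * x ^ 3 + B * x\<^sup>2 + C * x + D = 0"
    and "3 * A * x\<^sup>2 + 2 * B * x + C = 0"
  shows "x \<in> \<rat>"
proof -
  have lin: "(6 * A * C - 2 * B\<^sup>2) * x = B * C - 9 * A * D"
    using assms(6,7) by algebra
  show ?thesis
  proof (cases "6 * A * C - 2 * B\<^sup>2 = 0")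
    case True
    then have "(3 * A * x + B)\<^sup>2 = 0" using assms(7) by algebra
    then have "x = - B / (3 * A)" using assms(5) by (simp add: field_simps)
    then show ?thesis using assms by simp
  next
    case False
    then have "x = (B * C - 9 * A * D) / (6 * A * C - 2 * B\<^sup>2)" using lin by (simp add: field_simps)
    then show ?thesis using assms by simp
  qed
qed

lemma rational_relation_imp_integer_relation:
  fixes e u v :: "'a::real_vector"
  assumes "p \<in> \<rat>" "q \<in> \<rat>" "r \<in> \<rat>" "r \<noteq> 0"
    and rel: "p *\<^sub>R e + q *\<^sub>R u + r *\<^sub>R v = 0"
  shows "\<exists>l m n. (l \<noteq> 0 \<or> m \<noteq> 0 \<or> n \<noteq> 0) \<and> zscale l e + zscale m u + zscale n v = 0"
proof -
  obtain p1 p2 where p: "p2 \<noteq> 0" "p = of_int p1 / of_int p2"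
    using Rats_cases'[OF assms(1)] by (metis less_irrefl)
  obtain q1 q2 where q: "q2 \<noteq> 0" "q = of_int q1 / of_int q2"
    using Rats_cases'[OF assms(2)] by (metis less_irrefl)
  obtain r1 r2 where r: "r2 \<noteq> 0" "r = of_int r1 / of_int r2"
    using Rats_cases'[OF assms(3)] by (metis less_irrefl)
  note * = p q r
  have "zscale (p1 * q2 * r2) e + zscale (q1 * p2 * r2) u + zscale (r1 * p2 * q2) v =
      (p2 * q2 * r2) *\<^sub>R (p *\<^sub>R e + q *\<^sub>R u + r *\<^sub>R v)"
    using * by (simp add: algebra_simps)
  then have "zscale (p1 * q2 * r2) e + zscale (q1 * p2 * r2) u + zscale (r1 * p2 * q2) v = 0"
    using rel by simp
  moreover have "r1 * p2 * q2 \<noteq> 0" using * assms(4) by auto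
  ultimately show ?thesis by blast
qed

text \<open>A relation expresses a multiple of one generator by the other two. Hence an infinite
  intersection forces independence over the integers.\<close>

lemma finite_circle_of_relation:
  fixes p q r :: "real ^ 2"
  assumes "l \<noteq> 0 \<or> m \<noteq> 0 \<or> n \<noteq> 0" "zscale l p + zscale m q + zscale n r = 0"
  shows "finite {x. norm x = K \<and> (\<exists>X Y Z. x = zscale X p + zscale Y q + zscale Z r)}" (is "finite ?S")
proof -
  have *: "finite {x. norm x = K \<and> (\<exists>X Y Z. x = zscale X p + zscale Y q + zscale Z r)}"
    if "n \<noteq> 0" "zscale l p + zscale m q + zscale n r = 0" for l m n and p q r :: "real ^ 2"
  proof (rule finite_subset[OF _ finite_rank2_circle[of "real_of_int n" K p q]])
    have "zscale n (zscale X p + zscale Y q + zscale Z r) =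
      zscale (n * X - l * Z) p + zscale (n * Y - m * Z) q" for X Y Z
    proof -
      have "zscale n (zscale X p + zscale Y q + zscale Z r) =
        zscale (n * X - l * Z) p + zscale (n * Y - m * Z) q
          + zscale Z (zscale l p + zscale m q + zscale n r)" by (simp add: algebra_simps)
      then show ?thesis using that by simp
    qed
    then show "{x. norm x = K \<and> (\<exists>X Y Z. x = zscale X p + zscale Y q + zscale Z r)}
        \<subseteq> {x. norm x = K \<and> (\<exists>X Y. zscale n x = zscale X p + zscale Y q)}"
      by blast
  qed (use that in auto)
  consider "n \<noteq> 0" | "m \<noteq> 0" | "l \<noteq> 0" using assms by auto
  then show ?thesis
  proof cases
    case 1 then show ?thesis using * assms(2) by blast
  next
    case 2
    have rel: "zscale l p + zscale n r + zscale m q = 0" using assms(2) by (simp add: add_ac)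
    show ?thesis
    proof (rule finite_subset[OF _ *[OF 2 rel]], rule subsetI)
      fix x assume "x \<in> ?S"
      then obtain X Y Z where "norm x = K" "x = zscale X p + zscale Y q + zscale Z r" by blast
      then have "norm x = K \<and> x = zscale X p + zscale Z r + zscale Y q" by (simp add: add_ac)
      then show "x \<in> {x. norm x = K \<and> (\<exists>X Y Z. x = zscale X p + zscale Y r + zscale Z q)}" by blast
    qed
  next
    case 3
    have rel: "zscale m q + zscale n r + zscale l p = 0" using assms(2) by (simp add: add_ac)
    show ?thesis
    proof (rule finite_subset[OF _ *[OF 3 rel]], rule subsetI)
      fix x assume "x \<in> ?S"
      then obtain X Y Z where "norm x = K" "x = zscale X p + zscale Y q + zscale Z r" by blast
      then have "norm x = K \<and> x = zscale Y q + zscale Z r + zscale X p" by (simp add: add_ac)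
      then show "x \<in> {x. norm x = K \<and> (\<exists>X Y Z. x = zscale X q + zscale Y r + zscale Z p)}" by blast
    qed
  qed
qed

text \<open>The cross product of two independent points is normal to all points. If all points are
  parallel to a nonzero one, an integer vector orthogonal to that one suffices.\<close>

lemma plane_of_zero_determinants:
  fixes x y z :: "'b \<Rightarrow> int"
  assumes det: "\<And>p q r. p \<in> T \<Longrightarrow> q \<in> T \<Longrightarrow> r \<in> T \<Longrightarrow>
    (y p * z q - z p * y q) * x r + (z p * x q - x p * z q) * y r + (x p * y q - y p * x q) * z r = 0"
  shows "\<exists>l m n. (l \<noteq> 0 \<or> m \<noteq> 0 \<or> n \<noteq> 0) \<and> (\<forall>p\<in>T. l * x p + m * y p + n * z p = 0)"
proof (cases "\<exists>p\<in>T. \<exists>q\<in>T. y p * z q - z p * y q \<noteq> 0 \<or> z p * x q - x p * z q \<noteq> 0 \<or> x p * y q - y p * x q \<noteq> 0")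
  case True
  then show ?thesis using det by blast
next
  case False
  then have c: "y p * z q = z p * y q" "z p * x q = x p * z q" "x p * y q = y p * x q"
    if "p \<in> T" "q \<in> T" for p q using that by auto
  show ?thesis
  proof (cases "\<exists>p\<in>T. x p \<noteq> 0 \<or> y p \<noteq> 0 \<or> z p \<noteq> 0")
    case True
    then obtain p where p: "p \<in> T" "x p \<noteq> 0 \<or> y p \<noteq> 0 \<or> z p \<noteq> 0" by blast
    consider "x p \<noteq> 0 \<or> y p \<noteq> 0" | "z p \<noteq> 0" using p by blast
    then show ?thesis
    proof cases
      case 1
      then have "(y p \<noteq> 0 \<or> - x p \<noteq> 0 \<or> (0::int) \<noteq> 0) \<and> (\<forall>q\<in>T. y p * x q + - x p * y q + 0 * z q = 0)"
        using c[OF p(1)] by auto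
      then show ?thesis by blast
    next
      case 2
      then have "(z p \<noteq> 0 \<or> (0::int) \<noteq> 0 \<or> - x p \<noteq> 0) \<and> (\<forall>q\<in>T. z p * x q + 0 * y q + - x p * z q = 0)"
        using c[OF p(1)] by auto
      then show ?thesis by blast
    qed
  next
    case False
    then have "((1::int) \<noteq> 0 \<or> (0::int) \<noteq> 0 \<or> (0::int) \<noteq> 0) \<and> (\<forall>q\<in>T. 1 * x q + 0 * y q + 0 * z q = 0)" by auto
    then show ?thesis by blast
  qed
qed

lemma cramer_rational:
  fixes a b c :: real
  assumes "x1*a + y1*b + z1*c \<in> \<rat>" "x2*a + y2*b + z2*c \<in> \<rat>" "x3*a + y3*b + z3*c \<in> \<rat>"
    and "{x1,y1,z1,x2,y2,z2,x3,y3,z3} \<subseteq> \<rat>"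
    and d: "(y1*z2 - z1*y2)*x3 + (z1*x2 - x1*z2)*y3 + (x1*y2 - y1*x2)*z3 \<noteq> 0" (is "?d \<noteq> 0")
  shows "a \<in> \<rat>" "b \<in> \<rat>" "c \<in> \<rat>"
proof -
  define k1 k2 k3 where k: "k1 = x1*a + y1*b + z1*c" "k2 = x2*a + y2*b + z2*c" "k3 = x3*a + y3*b + z3*c"
  have r: "k1 \<in> \<rat>" "k2 \<in> \<rat>" "k3 \<in> \<rat>" using assms k by auto
  have q: "x1 \<in> \<rat>" "y1 \<in> \<rat>" "z1 \<in> \<rat>" "x2 \<in> \<rat>" "y2 \<in> \<rat>" "z2 \<in> \<rat>" "x3 \<in> \<rat>" "y3 \<in> \<rat>" "z3 \<in> \<rat>"
    using assms(4) by auto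
  have "?d * a = (y1*z2 - z1*y2)*k3 + (y2*z3 - z2*y3)*k1 + (y3*z1 - z3*y1)*k2"
    "?d * b = (z1*x2 - x1*z2)*k3 + (z2*x3 - x2*z3)*k1 + (z3*x1 - x3*z1)*k2"
    "?d * c = (x1*y2 - y1*x2)*k3 + (x2*y3 - y2*x3)*k1 + (x3*y1 - y3*x1)*k2"
    unfolding k by algebra+
  then have "a = ((y1*z2 - z1*y2)*k3 + (y2*z3 - z2*y3)*k1 + (y3*z1 - z3*y1)*k2) / ?d"
    "b = ((z1*x2 - x1*z2)*k3 + (z2*x3 - x2*z3)*k1 + (z3*x1 - x3*z1)*k2) / ?d"
    "c = ((x1*y2 - y1*x2)*k3 + (x2*y3 - y2*x3)*k1 + (x3*y1 - y3*x1)*k2) / ?d"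
    using d by (metis nonzero_mult_div_cancel_left)+
  then show "a \<in> \<rat>" "b \<in> \<rat>" "c \<in> \<rat>" using r q by simp_all
qed

section \<open>Asymptotic direction of the integer solutions\<close>

text \<open>Bounded norm keeps \<open>(X, Y, Z)\<close> within bounded distance of the line through
  \<open>(w1, w2, w3)\<close>. Infinitely many solutions therefore escape along it, and the leading
  term of the equation is its value at \<open>w\<close>. Contrapositively, a nonzero value bounds
  all coordinates.\<close>

lemma kernel_isotropic:
  fixes e u v :: "real ^ 2" and r s t :: real
  assumes unit: "norm e = 1" "norm u = 1"
    and eu: "det2 e u \<noteq> 0"
    and inf: "infinite {x. norm x = K \<and> (\<exists>X Y Z. x = zscale X e + zscale Y u + zscale Z v \<and>
              r * X * Y + s * X * Z + t * Y * Z = 0)}" (is "infinite ?S")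
  defines "w1 \<equiv> det2 u v" and "w2 \<equiv> det2 v e" and "w3 \<equiv> det2 e u"
  shows "r * w1 * w2 + s * w1 * w3 + t * w2 * w3 = 0"
proof (rule ccontr)
  define cw where "cw = r * w1 * w2 + s * w1 * w3 + t * w2 * w3"
  assume "\<not> ?thesis"
  then have cw: "cw \<noteq> 0" by (simp add: cw_def)
  \<comment> \<open>\<open>M1\<close> bounds the coefficient of \<open>Z\<close> and
    \<open>M2\<close> the constant term of the quadratic in \<open>Z\<close> below;
    \<open>R'\<close> then bounds \<open>X\<close> and \<open>Y\<close>. The 1 in \<open>R\<close>
    keeps it nonnegative.\<close>
  define M1 where "M1 = K * (\<bar>r * w1\<bar> + \<bar>r * w2\<bar> + \<bar>s * w3\<bar> + \<bar>t * w3\<bar>)"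
  define M2 where "M2 = \<bar>r\<bar> * K * K"
  define R where "R = max 1 ((M1 + M2) / \<bar>cw\<bar>)"
  define R' where "R' = (K + R * max \<bar>w1\<bar> \<bar>w2\<bar>) / \<bar>w3\<bar>"
  let ?I = "{X::int. \<bar>real_of_int X\<bar> \<le> R}" and ?J = "{X::int. \<bar>real_of_int X\<bar> \<le> R'}"
  have "?S \<subseteq> (\<lambda>(X, Y, Z). zscale X e + zscale Y u + zscale Z v) ` (?J \<times> ?J \<times> ?I)"
  proof clarify
    fix x X Y Z
    define m where "m = zscale X e + zscale Y u + zscale Z v"
    assume K: "K = norm (zscale X e + zscale Y u + zscale Z v)" and C: "r * real_of_int X * real_of_int Y + s * X * Z + t * Y * Z = 0"
    have K: "K = norm m" using K by (simp add: m_def)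
    \<comment> \<open>Deviations from the direction \<open>w\<close>; being determinants of
      \<open>m\<close> with unit vectors up to sign, they are at most \<open>K\<close> in
      modulus.\<close>
    define \<alpha> \<beta> where "\<alpha> = X * w3 - Z * w1" and "\<beta> = Y * w3 - Z * w2"
    have "\<alpha> = det2 m u" "\<beta> = - det2 m e"
      using det2_swap[of u v] det2_swap[of e v] det2_swap[of e u]
      by (simp_all add: \<alpha>_def \<beta>_def m_def w1_def w2_def w3_def det2_add_left det2_scale_left)
    then have ab: "\<bar>\<alpha>\<bar> \<le> K" "\<bar>\<beta>\<bar> \<le> K"
      using abs_det2_le[of m u] abs_det2_le[of m e] unit K by auto
    have "K \<ge> 0" using K by simp
    have XY: "X * w3 = Z * w1 + \<alpha>" "Y * w3 = Z * w2 + \<beta>" by (simp_all add: \<alpha>_def \<beta>_def)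
    \<comment> \<open>The equation times the square of \<open>w3\<close>, ordered by powers of
      \<open>Z\<close>.\<close>
    have "(real_of_int Z)\<^sup>2 * cw + Z * (r * w1 * \<beta> + r * w2 * \<alpha> + s * w3 * \<alpha> + t * w3 * \<beta>) + r * \<alpha> * \<beta> =
       r * (Z * w1 + \<alpha>) * (Z * w2 + \<beta>) + s * (Z * w1 + \<alpha>) * (Z * w3) + t * (Z * w2 + \<beta>) * (Z * w3)"
      unfolding cw_def by algebra
    also have "\<dots> = w3\<^sup>2 * (r * X * Y + s * X * Z + t * Y * Z)"
      unfolding XY[symmetric] by algebra
    finally have eq: "(real_of_int Z)\<^sup>2 * cw = - (Z * (r * w1 * \<beta> + r * w2 * \<alpha> + s * w3 * \<alpha> + t * w3 * \<beta>)) - r * \<alpha> * \<beta>"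
      using C by simp
    have Z: "\<bar>real_of_int Z\<bar> \<le> R"
    proof (cases "Z = 0")
      case True then show ?thesis by (simp add: R_def)
    next
      case False
      then have Z1: "\<bar>real_of_int Z\<bar> \<ge> 1" by (metis of_int_1_le_iff of_int_abs zabs_less_one_iff not_le)
      have "\<bar>r * w1 * \<beta> + r * w2 * \<alpha> + s * w3 * \<alpha> + t * w3 * \<beta>\<bar> \<le>
         \<bar>r * w1 * \<beta>\<bar> + \<bar>r * w2 * \<alpha>\<bar> + \<bar>s * w3 * \<alpha>\<bar> + \<bar>t * w3 * \<beta>\<bar>" by linarith
      also have "\<dots> = \<bar>r * w1\<bar> * \<bar>\<beta>\<bar> + \<bar>r * w2\<bar> * \<bar>\<alpha>\<bar> + \<bar>s * w3\<bar> * \<bar>\<alpha>\<bar> + \<bar>t * w3\<bar> * \<bar>\<beta>\<bar>"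
        by (simp add: abs_mult)
      also have "\<dots> \<le> \<bar>r * w1\<bar> * K + \<bar>r * w2\<bar> * K + \<bar>s * w3\<bar> * K + \<bar>t * w3\<bar> * K"
        using ab by (intro add_mono mult_left_mono) auto
      also have "\<dots> = M1" by (simp add: M1_def algebra_simps)
      finally have b1: "\<bar>r * w1 * \<beta> + r * w2 * \<alpha> + s * w3 * \<alpha> + t * w3 * \<beta>\<bar> \<le> M1" .
      have b2: "\<bar>r * \<alpha> * \<beta>\<bar> \<le> M2"
        unfolding M2_def abs_mult using ab \<open>K \<ge> 0\<close> by (intro mult_mono) auto
      have "\<bar>real_of_int Z\<bar> * (\<bar>real_of_int Z\<bar> * \<bar>cw\<bar>) = \<bar>(real_of_int Z)\<^sup>2 * cw\<bar>" by (simp add: abs_mult power2_eq_square)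
      also have "\<dots> \<le> \<bar>Z * (r * w1 * \<beta> + r * w2 * \<alpha> + s * w3 * \<alpha> + t * w3 * \<beta>)\<bar> + \<bar>r * \<alpha> * \<beta>\<bar>"
        unfolding eq by linarith
      also have "\<dots> \<le> \<bar>real_of_int Z\<bar> * M1 + \<bar>real_of_int Z\<bar> * M2"
      proof (rule add_mono)
        show "\<bar>Z * (r * w1 * \<beta> + r * w2 * \<alpha> + s * w3 * \<alpha> + t * w3 * \<beta>)\<bar> \<le> \<bar>real_of_int Z\<bar> * M1"
          unfolding abs_mult[of "real_of_int Z"] using b1 by (intro mult_left_mono) auto
        have "1 * M2 \<le> \<bar>real_of_int Z\<bar> * M2" using Z1 b2 by (intro mult_right_mono) auto
        then show "\<bar>r * \<alpha> * \<beta>\<bar> \<le> \<bar>real_of_int Z\<bar> * M2" using b2 by linarith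
      qed
      also have "\<dots> = \<bar>real_of_int Z\<bar> * (M1 + M2)" by (simp add: algebra_simps)
      finally have "\<bar>real_of_int Z\<bar> * \<bar>cw\<bar> \<le> M1 + M2"
        using Z1 mult_le_cancel_left_pos[of "\<bar>real_of_int Z\<bar>"] by simp
      then show ?thesis using cw by (simp add: R_def field_simps le_max_iff_disj)
    qed
    have bd: "\<bar>real_of_int W\<bar> \<le> R'" if "W * w3 = Z * w + \<gamma>" "\<bar>\<gamma>\<bar> \<le> K" "\<bar>w\<bar> \<le> max \<bar>w1\<bar> \<bar>w2\<bar>" for W :: int and w \<gamma> :: real
    proof -
      have "\<bar>real_of_int W\<bar> * \<bar>w3\<bar> = \<bar>Z * w + \<gamma>\<bar>" using that by (simp flip: abs_mult)
      also have "\<dots> \<le> \<bar>real_of_int Z\<bar> * \<bar>w\<bar> + \<bar>\<gamma>\<bar>"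
        unfolding abs_mult[symmetric] by (rule abs_triangle_ineq)
      also have "\<dots> \<le> R * max \<bar>w1\<bar> \<bar>w2\<bar> + K"
        using Z that by (intro add_mono mult_mono) (auto simp: R_def le_max_iff_disj)
      finally show ?thesis using eu by (simp add: R'_def w3_def field_simps)
    qed
    have "\<bar>real_of_int X\<bar> \<le> R'" "\<bar>real_of_int Y\<bar> \<le> R'" using bd[OF XY(1)] bd[OF XY(2)] ab by auto
    then show "zscale X e + zscale Y u + zscale Z v \<in> (\<lambda>(X, Y, Z). zscale X e + zscale Y u + zscale Z v) ` (?J \<times> ?J \<times> ?I)"
      using Z by (intro image_eqI[of _ _ "(X, Y, Z)"]) auto
  qed
  then have "finite ?S"
    by (rule finite_subset) (intro finite_imageI finite_cartesian_product finite_int_abs_le)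
  with inf show False by simp
qed

section \<open>Relations from parallel vectors and rational Gram matrices\<close>

text \<open>Parallel unit vectors agree up to sign.\<close>

lemma parallel_unit_imp_relation:
  assumes "norm e = 1" "norm u = 1" "det2 e u = 0"
  shows "\<exists>l m n. (l \<noteq> 0 \<or> m \<noteq> 0 \<or> n \<noteq> 0) \<and> zscale l e + zscale m u + zscale n v = 0"
proof -
  have n: "e \<bullet> e = 1" "u \<bullet> u = 1" using assms by (simp_all add: norm_eq_1)
  have a: "(e \<bullet> u)\<^sup>2 = 1"
    using det2_mult[of e u e u] assms(3) by (simp add: n inner_commute power2_eq_square)
  have "(u - (e \<bullet> u) *\<^sub>R e) \<bullet> (u - (e \<bullet> u) *\<^sub>R e) = 0"
    using a by (simp add: inner_diff_left inner_diff_right n inner_commute power2_eq_square)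
  then have "u = (e \<bullet> u) *\<^sub>R e" by simp
  moreover have "e \<bullet> u = 1 \<or> e \<bullet> u = -1" using a by (simp add: power2_eq_1_iff)
  ultimately have "zscale 1 e + zscale (-1) u + zscale 0 v = 0 \<or> zscale 1 e + zscale 1 u + zscale 0 v = 0"
    by force
  then show ?thesis by (metis one_neq_zero)
qed

text \<open>Multiplied by \<open>det2 e u\<close>, the coefficients of \<open>det2_relation\<close>
  become minors of the Gram matrix, hence rational.\<close>

lemma rational_gram_imp_relation:
  fixes e u v :: "real ^ 2"
  assumes unit: "norm e = 1" "norm u = 1" "norm v = 1"
    and rat: "e \<bullet> u \<in> \<rat>" "e \<bullet> v \<in> \<rat>" "u \<bullet> v \<in> \<rat>"
  shows "\<exists>l m n. (l \<noteq> 0 \<or> m \<noteq> 0 \<or> n \<noteq> 0) \<and> zscale l e + zscale m u + zscale n v = 0"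
proof -
  have n: "e \<bullet> e = 1" "u \<bullet> u = 1" "v \<bullet> v = 1" using unit by (simp_all add: norm_eq_1)
  show ?thesis
  proof (cases "det2 e u = 0")
    case False
    define w3 where "w3 = det2 e u"
    have "(det2 u v * w3) *\<^sub>R e + (det2 v e * w3) *\<^sub>R u + (w3 * w3) *\<^sub>R v
       = w3 *\<^sub>R (det2 u v *\<^sub>R e + det2 v e *\<^sub>R u + det2 e u *\<^sub>R v)"
      by (simp add: w3_def algebra_simps)
    also have "\<dots> = 0" by (simp add: det2_relation)
    finally have rel: "(det2 u v * w3) *\<^sub>R e + (det2 v e * w3) *\<^sub>R u + (w3 * w3) *\<^sub>R v = 0" .
    show ?thesis
    proof (rule rational_relation_imp_integer_relation[OF _ _ _ _ rel])
      show "det2 u v * w3 \<in> \<rat>" "det2 v e * w3 \<in> \<rat>" "w3 * w3 \<in> \<rat>"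
        using rat by (simp_all add: w3_def det2_mult n inner_commute)
      show "w3 * w3 \<noteq> 0" using False by (simp add: w3_def)
    qed
  next
    case True
    then show ?thesis using parallel_unit_imp_relation unit by blast
  qed
qed

section \<open>Groups generated by three unit vectors\<close>

text \<open>A general radius allows for the common denominator that arises when other unit vectors
  are expressed by \<open>e\<close>, \<open>u\<close>, \<open>v\<close>.\<close>

lemma finite_rank3_circle:
  fixes e u v :: "real ^ 2"
  assumes unit: "norm e = 1" "norm u = 1" "norm v = 1"
    and K: "K\<^sup>2 \<in> \<rat>"
  shows "finite {x. norm x = K \<and> (\<exists>X Y Z. x = zscale X e + zscale Y u + zscale Z v)}" (is "finite ?S")
proof (rule ccontr)
  assume inf: "infinite ?S"
  define a b c where abc: "a = e \<bullet> u" "b = e \<bullet> v" "c = u \<bullet> v"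
  define vec where "vec = (\<lambda>(X, Y, Z). zscale X e + zscale Y u + zscale Z v)"
  define T where "T = {p. norm (vec p) = K}"
  have S: "?S = vec ` T"
    unfolding T_def vec_def image_def by auto
  have n: "e \<bullet> e = 1" "u \<bullet> u = 1" "v \<bullet> v = 1" using unit by (simp_all add: norm_eq_1)
  have irr: "\<not> (a \<in> \<rat> \<and> b \<in> \<rat> \<and> c \<in> \<rat>)"
    using rational_gram_imp_relation[OF unit] finite_circle_of_relation inf unfolding abc by blast
  have eu: "det2 e u \<noteq> 0"
    using parallel_unit_imp_relation[OF unit(1,2)] finite_circle_of_relation inf by blast
  have plane: "finite (vec ` {(X, Y, Z) \<in> T. l * X + m * Y + n * Z = 0})"
    if "l \<noteq> 0 \<or> m \<noteq> 0 \<or> n \<noteq> 0" for l m n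
    by (rule finite_subset[OF _ finite_plane_circle[OF that, of K e u v]]) (auto simp: T_def vec_def)
  \<comment> \<open>The norm equation, read as a linear equation for \<open>a\<close>,
    \<open>b\<close>, \<open>c\<close>.\<close>
  have Q: "X * Y * a + X * Z * b + Y * Z * c = (K\<^sup>2 - X\<^sup>2 - Y\<^sup>2 - Z\<^sup>2) / 2" if "(X, Y, Z) \<in> T" for X Y Z
  proof -
    have "K\<^sup>2 = vec (X, Y, Z) \<bullet> vec (X, Y, Z)" using that by (simp add: T_def power2_norm_eq_inner flip: power2_norm_eq_inner)
    also have "\<dots> = X\<^sup>2 + Y\<^sup>2 + Z\<^sup>2 + 2 * (X * Y * a + X * Z * b + Y * Z * c)"
      by (simp add: vec_def inner_add_left inner_add_right n inner_commute abc power2_eq_square algebra_simps)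
    finally show ?thesis by simp
  qed
  have Qrat: "X * Y * a + X * Z * b + Y * Z * c \<in> \<rat>" if "(X, Y, Z) \<in> T" for X Y Z
    unfolding Q[OF that] using K by simp
  \<comment> \<open>Four rational planes contribute only finitely many vectors, so they cannot
    exhaust the infinite set.\<close>
  have avoid: "\<exists>X Y Z. (X, Y, Z) \<in> T \<and> X \<noteq> 0 \<and> Y \<noteq> 0 \<and> Z \<noteq> 0 \<and> l * X + m * Y + n * Z \<noteq> 0"
    if "l \<noteq> 0 \<or> m \<noteq> 0 \<or> n \<noteq> 0" for l m n
  proof (rule ccontr)
    assume "\<not> ?thesis"
    then have "?S \<subseteq> vec ` {(X, Y, Z) \<in> T. 1 * X + 0 * Y + 0 * Z = 0} \<union> vec ` {(X, Y, Z) \<in> T. 0 * X + 1 * Y + 0 * Z = 0}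
      \<union> vec ` {(X, Y, Z) \<in> T. 0 * X + 0 * Y + 1 * Z = 0} \<union> vec ` {(X, Y, Z) \<in> T. l * X + m * Y + n * Z = 0}"
      unfolding S image_Un[symmetric] by (intro image_mono) auto
    moreover have "finite \<dots>" using that by (intro finite_UnI plane) simp_all
    ultimately show False using inf finite_subset by blast
  qed
  obtain X1 Y1 Z1 where p1: "(X1, Y1, Z1) \<in> T" "X1 \<noteq> 0" "Y1 \<noteq> 0" "Z1 \<noteq> 0" using avoid[of 1 0 0] by auto
  \<comment> \<open>The last condition makes the products \<open>(X Y, X Z, Y Z)\<close> of the two
    points independent.\<close>
  obtain X2 Y2 Z2 where p2: "(X2, Y2, Z2) \<in> T" "X2 \<noteq> 0" "Z1 * Y2 - Y1 * Z2 \<noteq> 0"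
    using avoid[of 0 Z1 "- Y1"] p1 by auto
  \<comment> \<open>The cross product of these two vectors of products.\<close>
  define r s t where rst: "r = X1 * Z1 * (Y2 * Z2) - Y1 * Z1 * (X2 * Z2)"
    "s = Y1 * Z1 * (X2 * Y2) - X1 * Y1 * (Y2 * Z2)" "t = X1 * Y1 * (X2 * Z2) - X1 * Z1 * (X2 * Y2)"
  have "t = - X1 * X2 * (Z1 * Y2 - Y1 * Z2)" unfolding rst by algebra
  then have t0: "t \<noteq> 0" using p1 p2 by simp
  \<comment> \<open>A nonzero value would be the determinant of three equations with rational data,
    making \<open>a\<close>, \<open>b\<close>, \<open>c\<close> rational.\<close>
  have C: "r * (X * Y) + s * (X * Z) + t * (Y * Z) = 0" if "(X, Y, Z) \<in> T" for X Y Z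
  proof (rule ccontr)
    assume neq: "\<not> ?thesis"
    have "real_of_int (r * (X * Y) + s * (X * Z) + t * (Y * Z)) \<noteq> 0"
      unfolding of_int_eq_0_iff by (rule neq)
    then have "a \<in> \<rat>" "b \<in> \<rat>" "c \<in> \<rat>"
      using cramer_rational[OF Qrat[OF p1(1)] Qrat[OF p2(1)] Qrat[OF that]] by (simp_all add: rst)
    then show False using irr by blast
  qed
  \<comment> \<open>If \<open>r\<close> were zero, the equation would factor and confine all points
    to two rational planes; likewise for \<open>s\<close>.\<close>
  have "r \<noteq> 0"
  proof
    assume "r = 0"
    obtain X Y Z where "(X, Y, Z) \<in> T" "Z \<noteq> 0" "s * X + t * Y + 0 * Z \<noteq> 0" using avoid[of s t 0] t0 by blast
    moreover from this have "Z * (s * X + t * Y + 0 * Z) = 0" using C \<open>r = 0\<close> by (force simp: algebra_simps)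
    ultimately show False by simp
  qed
  have "s \<noteq> 0"
  proof
    assume "s = 0"
    obtain X Y Z where "(X, Y, Z) \<in> T" "Y \<noteq> 0" "r * X + 0 * Y + t * Z \<noteq> 0" using avoid[of r 0 t] t0 by blast
    moreover from this have "Y * (r * X + 0 * Y + t * Z) = 0" using C \<open>s = 0\<close> by (force simp: algebra_simps)
    ultimately show False by simp
  qed
  define w1 w2 w3 where w: "w1 = det2 u v" "w2 = det2 v e" "w3 = det2 e u"
  have iso: "r * w1 * w2 + s * w1 * w3 + t * w2 * w3 = 0"
    unfolding w
  proof (rule kernel_isotropic[OF unit(1,2) eu])
    have "real_of_int r * X * Y + real_of_int s * X * Z + real_of_int t * Y * Z = 0" if "(X, Y, Z) \<in> T" for X Y Z
      using arg_cong[OF C[OF that], of real_of_int] by (simp add: mult.assoc)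
    then have "?S \<subseteq> {x. norm x = K \<and> (\<exists>X Y Z. x = zscale X e + zscale Y u + zscale Z v \<and>
              real_of_int r * X * Y + real_of_int s * X * Z + real_of_int t * Y * Z = 0)}"
      unfolding T_def vec_def mem_Collect_eq prod.case by blast
    then show "infinite \<dots>" using inf finite_subset by blast
  qed
  \<comment> \<open>The Gram matrix has rank two, so its adjugate has the entries \<open>wi * wj\<close>.\<close>
  have ww: "w1 * w2 = b * c - a" "w1 * w3 = a * c - b" "w2 * w3 = a * b - c" "w1 * w1 = 1 - c * c" "w3 * w3 = 1 - a * a"
    by (simp_all add: w det2_mult n abc inner_commute)
  \<comment> \<open>The Gram determinant, from two expressions for the square of
    \<open>w1 * w3\<close>.\<close>
  have det0: "1 + 2 * a * b * c - a\<^sup>2 - b\<^sup>2 - c\<^sup>2 = 0"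
  proof -
    have "(w1 * w3) * (w1 * w3) = (w1 * w1) * (w3 * w3)" by algebra
    then show ?thesis unfolding ww by algebra
  qed
  have iso': "r * (b * c - a) + s * (a * c - b) + t * (a * b - c) = 0"
    using iso unfolding ww[symmetric] by (simp add: mult.assoc)
  \<comment> \<open>\<open>(a, b, c)\<close> lies on a line of direction \<open>(r, s, t)\<close>,
    based at its point with first coordinate zero.\<close>
  define \<mu> \<beta> \<gamma> :: real where lbg: "\<mu> = a / r" "\<beta> = b - s * \<mu>" "\<gamma> = c - t * \<mu>"
  have a: "a = r * \<mu>" and b: "b = s * \<mu> + \<beta>" and c: "c = t * \<mu> + \<gamma>"
    using \<open>r \<noteq> 0\<close> by (simp_all add: lbg)
  define k1 where "k1 = X1 * Y1 * a + X1 * Z1 * b + Y1 * Z1 * c"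
  define k2 where "k2 = X2 * Y2 * a + X2 * Z2 * b + Y2 * Z2 * c"
  have k: "k1 \<in> \<rat>" "k2 \<in> \<rat>" using Qrat[OF p1(1)] Qrat[OF p2(1)] by (simp_all add: k1_def k2_def)
  \<comment> \<open>The triple product rule \<open>(p \<times> q) \<times> x = (p \<bullet> x) q -
    (q \<bullet> x) p\<close>, for the two vectors of products and
    \<open>x = (a, b, c)\<close>.\<close>
  have "r * b - s * a = Y2 * Z2 * k1 - Y1 * Z1 * k2" "r * c - t * a = X1 * Z1 * k2 - X2 * Z2 * k1"
    unfolding rst k1_def k2_def by (simp_all add: algebra_simps)
  then have "\<beta> = (Y2 * Z2 * k1 - Y1 * Z1 * k2) / r" "\<gamma> = (X1 * Z1 * k2 - X2 * Z2 * k1) / r"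
    using \<open>r \<noteq> 0\<close> by (simp_all add: lbg field_simps)
  then have rat: "\<beta> \<in> \<rat>" "\<gamma> \<in> \<rat>" using k by simp_all
  have "\<mu> \<in> \<rat>"
  proof (rule double_root_rational)
    \<comment> \<open>Coefficients of the Gram determinant as a cubic in \<open>\<mu>\<close>. By
      the chain rule its derivative is twice the left side of \<open>iso'\<close>.\<close>
    let ?A = "2 * real_of_int r * s * t"
    let ?B = "2 * real_of_int r * (s * \<gamma> + t * \<beta>) - r\<^sup>2 - s\<^sup>2 - t\<^sup>2"
    let ?C = "2 * real_of_int r * \<beta> * \<gamma> - 2 * s * \<beta> - 2 * t * \<gamma>"
    let ?D = "1 - \<beta>\<^sup>2 - \<gamma>\<^sup>2"
    show "?A \<in> \<rat>" "?B \<in> \<rat>" "?C \<in> \<rat>" "?D \<in> \<rat>" using rat by simp_all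
    show "?A \<noteq> 0" using \<open>r \<noteq> 0\<close> \<open>s \<noteq> 0\<close> t0 by simp
    show "?A * \<mu> ^ 3 + ?B * \<mu>\<^sup>2 + ?C * \<mu> + ?D = 0"
      using det0 unfolding a b c by simp algebra
    show "3 * ?A * \<mu>\<^sup>2 + 2 * ?B * \<mu> + ?C = 0"
      using iso' unfolding a b c by simp algebra
  qed
  then have "a \<in> \<rat>" "b \<in> \<rat>" "c \<in> \<rat>" unfolding a b c using rat by simp_all
  then show False using irr by blast
qed

section \<open>Reduction to three unit vectors\<close>

theorem theorem2:
  fixes A :: "(real ^ 2) set"
  assumes "additive_subgroup A"
    and "fin_gen A"
    and "z_rank A \<le> 3"
  shows "finite (A \<inter> sphere 0 1)"
proof -
  define S where "S = A \<inter> sphere 0 1"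
  have S1: "norm x = 1" if "x \<in> S" for x using that by (simp add: S_def)
  obtain p q r where pqr: "\<And>x. x \<in> A \<Longrightarrow> \<exists>X Y Z. x = zscale X p + zscale Y q + zscale Z r"
    using three_generators[OF assms(2,3)] by metis
  then obtain X Y Z where XYZ: "\<And>x. x \<in> S \<Longrightarrow> x = zscale (X x) p + zscale (Y x) q + zscale (Z x) r"
    unfolding S_def by (metis IntD1)
  define det where "det e u v = (Y e * Z u - Z e * Y u) * X v + (Z e * X u - X e * Z u) * Y v + (X e * Y u - Y e * X u) * Z v"
    for e u v
  have "finite S"
  \<comment> \<open>Either the coordinates lie in a rational plane, or three elements of
    \<open>S\<close> serve as new generators.\<close>
  proof (cases "\<forall>e\<in>S. \<forall>u\<in>S. \<forall>v\<in>S. det e u v = 0")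
    case True
    then obtain l m n where lmn: "l \<noteq> 0 \<or> m \<noteq> 0 \<or> n \<noteq> 0" "\<And>x. x \<in> S \<Longrightarrow> l * X x + m * Y x + n * Z x = 0"
      using plane_of_zero_determinants[of S Y Z X] unfolding det_def by metis
    have "S \<subseteq> {x. norm x = 1 \<and> (\<exists>X Y Z. l * X + m * Y + n * Z = 0 \<and>
           x = zscale X p + zscale Y q + zscale Z r)}"
      using lmn(2) XYZ S1 by blast
    then show ?thesis using finite_plane_circle[OF lmn(1)] finite_subset by blast
  next
    case False
    then obtain e u v where euv: "e \<in> S" "u \<in> S" "v \<in> S" "det e u v \<noteq> 0" by blast
    define D where "D = det e u v"
    let ?K = "{x. norm x = \<bar>real_of_int D\<bar> \<and> (\<exists>X Y Z. x = zscale X e + zscale Y u + zscale Z v)}"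
    have "S \<subseteq> (\<lambda>x. (1 / D) *\<^sub>R x) ` ?K"
    proof
      fix x assume x: "x \<in> S"
      \<comment> \<open>Cramer's rule over the integers: only the multiple by \<open>D\<close> need
        be an integer combination.\<close>
      have "zscale D x = zscale (det x u v) e + zscale (det e x v) u + zscale (det e u x) v"
      proof -
        have "zscale D (zscale (X x) p + zscale (Y x) q + zscale (Z x) r) =
           zscale (det x u v) (zscale (X e) p + zscale (Y e) q + zscale (Z e) r) +
           zscale (det e x v) (zscale (X u) p + zscale (Y u) q + zscale (Z u) r) +
           zscale (det e u x) (zscale (X v) p + zscale (Y v) q + zscale (Z v) r)"
          unfolding D_def det_def by (simp add: algebra_simps)
        then show ?thesis using XYZ x euv by simp
      qed
      moreover have "norm (zscale D x) = \<bar>real_of_int D\<bar>" using S1[OF x] by simp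
      ultimately have "zscale D x \<in> ?K" by blast
      moreover have "x = (1 / D) *\<^sub>R zscale D x" using euv(4) by (simp add: D_def)
      ultimately show "x \<in> (\<lambda>x. (1 / D) *\<^sub>R x) ` ?K" by blast
    qed
    moreover have "finite ?K" using finite_rank3_circle S1 euv by simp
    ultimately show ?thesis using finite_surj by blast
  qed
  then show ?thesis by (simp add: S_def)
qed

end
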